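(* Let $G$ be a compactly presented locally compact group with compact symmetric generating set $S$, let $\delta$ be its Dehn function, and let $\mathcal{F}$ be an efficient set of words in $S$, with efficiency constant $C$. Then for every integer $k\ge1$ and every real $n>0$ we have $$\delta(n)\le k\,\delta\left((C+1)\left\lceil \frac nk\right\rceil\right)+\delta_{\mathcal{F}[k]}\left(Ck\left\lceil \frac nk\right\rceil\right);$$ in particular, for $n\ge k$ we have $$\delta(n)\le k\,\delta\left((C+1)\frac{2n}k\right)+\delta_{\mathcal{F}[k]}(2Cn).$$
   Context: Compact presentability means that there is an integer $\ell$ such that the abstract group $G$ has a presentation with generating set $S$ and relators of length $\le\ell$; fix such $(S,\ell)$. A relation (null-homotopic word) is a word in the letters of $S$ representing the trivial element of $G$; its area is the least $m$ such that it is, in the free group on $S$, a product of $\le m$ conjugates of relations of length $\le\ell$. For real $x\ge 0$, the Dehn function is $\delta(x)=\sup\{\mathrm{area}(w): w\text{ a relation of length}\le x\}$. For words $w,w'$ in $S$, $w\equiv w'$ means they represent the same element of $G$, and $|w|_S$ is the length of the word $w$. $\lceil x\rceil$ is the least integer $\ge x$. For a set $\mathcal{F}$ of words in $S$, $\mathcal{F}[k]$ is the set of words obtained as the concatenation of $\le k$ words of $\mathcal{F}$. For real $x\ge 0$, the restricted Dehn function $\delta_{\mathcal{F}}(x)$ is the supremum of the areas of the null-homotopic words of length $\le x$ belonging to $\mathcal{F}$ (with $\sup\emptyset=0$). The set $\mathcal{F}$ is efficient, with efficiency constant $C$, if for every word $w$ in $S$ there exists $w'\in\mathcal{F}$ with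 $w'\equiv w$ and $|w'|_S\le C|w|_S$. *)

theory Defs
  imports "HOL-Analysis.Analysis" "HOL-Algebra.Generated_Groups"
    "HOL-Library.Extended_Nat"
begin

text \<open>As usual, locally compact groups are Hausdorff.\<close>

definition locally_compact_group :: "('a, 'b) monoid_scheme \<Rightarrow> 'a topology \<Rightarrow> bool" where
  "locally_compact_group G T \<longleftrightarrow>
     group G \<and> topspace T = carrier G \<and>
     continuous_map (prod_topology T T) T (\<lambda>(x, y). x \<otimes>\<^bsub>G\<^esub> y) \<and>
     continuous_map T T (\<lambda>x. inv\<^bsub>G\<^esub> x) \<and>
     Hausdorff_space T \<and> locally_compact_space T"

definition symmetric_subset :: "('a, 'b) monoid_scheme \<Rightarrow> 'a set \<Rightarrow> bool" where
  "symmetric_subset G S \<longleftrightarrow> S \<subseteq> carrier G \<and> (\<forall>s\<in>S. inv\<^bsub>G\<^esub> s \<in> S)"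

text \<open>
  Words represent elements of the free group on \<open>S\<close>: the letter \<open>(s, True)\<close> stands for
  the generator \<open>s\<close> and \<open>(s, False)\<close> for its formal inverse. Even when \<open>S\<close> is a symmetric
  subset of a group, \<open>(s, False)\<close> is not identified with the letter of the element inverse to \<open>s\<close>;
  the two letters have the same value in the group but differ in the free group on \<open>S\<close>.
  Words need not be reduced.
\<close>

type_synonym 'a word = "('a \<times> bool) list"

definition words :: "'a set \<Rightarrow> 'a word set" where
  "words S = lists (S \<times> UNIV)"

definition inv_word :: "'a word \<Rightarrow> 'a word" where
  "inv_word w = rev (map (\<lambda>(s, b). (s, \<not> b)) w)"

text \<open>Equality in the free group on \<open>S\<close> of the elements represented by two words.\<close>

inductive_set free_rel :: "'a set \<Rightarrow> ('a word \<times> 'a word) set" for S :: "'a set" where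
  cancel: "u \<in> words S \<Longrightarrow> v \<in> words S \<Longrightarrow> s \<in> S \<Longrightarrow>
    (u @ [(s, b), (s, \<not> b)] @ v, u @ v) \<in> free_rel S"
| refl: "u \<in> words S \<Longrightarrow> (u, u) \<in> free_rel S"
| sym: "(u, v) \<in> free_rel S \<Longrightarrow> (v, u) \<in> free_rel S"
| trans: "(u, v) \<in> free_rel S \<Longrightarrow> (v, w) \<in> free_rel S \<Longrightarrow> (u, w) \<in> free_rel S"

definition conj_prod :: "('a word \<times> 'a word) list \<Rightarrow> 'a word" where
  "conj_prod ps = concat (map (\<lambda>(u, r). u @ r @ inv_word u) ps)"

definition word_value :: "('a, 'b) monoid_scheme \<Rightarrow> 'a word \<Rightarrow> 'a" where
  "word_value G w =
     foldr (\<lambda>(s, b) g. (if b then s else inv\<^bsub>G\<^esub> s) \<otimes>\<^bsub>G\<^esub> g) w \<one>\<^bsub>G\<^esub>"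

definition relations :: "('a, 'b) monoid_scheme \<Rightarrow> 'a set \<Rightarrow> 'a word set" where
  "relations G S = {w \<in> words S. word_value G w = \<one>\<^bsub>G\<^esub>}"

text \<open>
  \<open>\<langle>S | R\<rangle>\<close> presents \<open>G\<close>: the canonical homomorphism from the free group on \<open>S\<close> to \<open>G\<close> is
  surjective and its kernel is the normal closure of \<open>R\<close>.
\<close>

definition is_presentation :: "('a, 'b) monoid_scheme \<Rightarrow> 'a set \<Rightarrow> 'a word set \<Rightarrow> bool" where
  "is_presentation G S R \<longleftrightarrow>
     S \<subseteq> carrier G \<and> generate G S = carrier G \<and> R \<subseteq> words S \<and>
     relations G S =
       {w. \<exists>ps. set ps \<subseteq> words S \<times> (R \<union> inv_word ` R) \<and> (w, conj_prod ps) \<in> free_rel S}"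

definition presented_with_relators_le :: "('a, 'b) monoid_scheme \<Rightarrow> 'a set \<Rightarrow> nat \<Rightarrow> bool" where
  "presented_with_relators_le G S l \<longleftrightarrow>
     (\<exists>R. is_presentation G S R \<and> (\<forall>r\<in>R. length r \<le> l))"

text \<open>Areas and their suprema are valued in \<open>enat\<close>, where \<open>Inf {} = \<infinity>\<close> and \<open>Sup {} = 0\<close>.\<close>

definition area :: "('a, 'b) monoid_scheme \<Rightarrow> 'a set \<Rightarrow> nat \<Rightarrow> 'a word \<Rightarrow> enat" where
  "area G S l w = Inf {enat m | m. \<exists>ps. length ps \<le> m \<and>
     set ps \<subseteq> words S \<times> {r \<in> relations G S. length r \<le> l} \<and>
     (w, conj_prod ps) \<in> free_rel S}"

definition dehn :: "('a, 'b) monoid_scheme \<Rightarrow> 'a set \<Rightarrow> nat \<Rightarrow> real \<Rightarrow> enat" where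
  "dehn G S l x = Sup (area G S l ` {w \<in> relations G S. real (length w) \<le> x})"

definition restricted_dehn ::
    "('a, 'b) monoid_scheme \<Rightarrow> 'a set \<Rightarrow> nat \<Rightarrow> 'a word set \<Rightarrow> real \<Rightarrow> enat" where
  "restricted_dehn G S l F x =
     Sup (area G S l ` {w \<in> relations G S. real (length w) \<le> x \<and> w \<in> F})"

definition concats :: "'a word set \<Rightarrow> nat \<Rightarrow> 'a word set" where
  "concats F k = {concat ws | ws. set ws \<subseteq> F \<and> length ws \<le> k}"

definition efficient :: "('a, 'b) monoid_scheme \<Rightarrow> 'a set \<Rightarrow> 'a word set \<Rightarrow> real \<Rightarrow> bool" where
  "efficient G S F C \<longleftrightarrow>
     (\<forall>w\<in>words S. \<exists>w'\<in>F. word_value G w' = word_value G w \<and>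
        real (length w') \<le> C * real (length w))"

end

theory Submission
  imports Defs
begin

text \<open>
  Cut a relation \<open>w\<close> of length at most \<open>n\<close> into \<open>k\<close> pieces of length at most \<open>\<lceil>n / k\<rceil>\<close> and replace
  each piece \<open>u\<close> by an equivalent \<open>v \<in> F\<close> with \<open>|v| \<le> C |u|\<close>. In the free group
  \<open>x u y = x (u v\<^sup>-\<^sup>1) x\<^sup>-\<^sup>1 \<cdot> x v y\<close>, so each replacement costs at most the area of the relation
  \<open>u v\<^sup>-\<^sup>1\<close>, of length at most \<open>(C + 1) \<lceil>n / k\<rceil>\<close>. After \<open>k\<close> replacements a relation in \<open>F[k]\<close> remains.
\<close>

section \<open>Words and formal inverses\<close>

lemma Nil_in_words [simp]: "[] \<in> words S"
  by (simp add: words_def)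

lemma append_in_words_iff [simp]: "u @ v \<in> words S \<longleftrightarrow> u \<in> words S \<and> v \<in> words S"
  by (auto simp: words_def)

lemma Cons_in_words_iff [simp]: "(s, b) # w \<in> words S \<longleftrightarrow> s \<in> S \<and> w \<in> words S"
  by (auto simp: words_def)

lemma concat_in_words_iff: "concat ws \<in> words S \<longleftrightarrow> set ws \<subseteq> words S"
  by (induction ws) auto

lemma inv_word_Nil [simp]: "inv_word [] = []"
  by (simp add: inv_word_def)

lemma inv_word_Cons [simp]: "inv_word ((s, b) # w) = inv_word w @ [(s, \<not> b)]"
  by (simp add: inv_word_def)

lemma inv_word_append [simp]: "inv_word (u @ v) = inv_word v @ inv_word u"
  by (simp add: inv_word_def)

lemma length_inv_word [simp]: "length (inv_word w) = length w"
  by (simp add: inv_word_def)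

lemma inv_word_inv_word [simp]: "inv_word (inv_word w) = w"
  by (induction w) (auto simp: inv_word_def)

lemma inv_word_in_words [simp]: "w \<in> words S \<Longrightarrow> inv_word w \<in> words S"
  by (induction w) auto

section \<open>Equality in the free group as a congruence\<close>

text \<open>A cancellation is already allowed between arbitrary words, so \<open>x\<close> and
  \<open>y\<close> are absorbed into its two outer words; the remaining rules carry over
  directly.\<close>

lemma free_rel_context:
  assumes "(u, v) \<in> free_rel S" "x \<in> words S" "y \<in> words S"
  shows "(x @ u @ y, x @ v @ y) \<in> free_rel S"
  using assms(1)
proof induction
  case (cancel u v s b)
  then show ?case
    using free_rel.cancel[of "x @ u" S "v @ y" s b] assms by simp
next
  case (refl u)
  then show ?case using assms by (simp add: free_rel.refl)
next
  case (sym u v)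
  then show ?case by (blast intro: free_rel.sym)
next
  case (trans u v w)
  then show ?case by (blast intro: free_rel.trans)
qed

lemma free_rel_in_words:
  assumes "(u, v) \<in> free_rel S"
  shows "u \<in> words S" "v \<in> words S"
  using assms by (induction) auto

lemma free_rel_append:
  assumes "(u, u') \<in> free_rel S" "(v, v') \<in> free_rel S"
  shows "(u @ v, u' @ v') \<in> free_rel S"
  using free_rel_context[OF assms(1) Nil_in_words free_rel_in_words(1)[OF assms(2)]]
    free_rel_context[OF assms(2) free_rel_in_words(2)[OF assms(1)] Nil_in_words]
  by (auto intro: free_rel.trans)

lemma append_inv_word_free_rel:
  "w \<in> words S \<Longrightarrow> (w @ inv_word w, []) \<in> free_rel S"
proof (induction w)
  case Nil
  then show ?case by (simp add: free_rel.refl)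
next
  case (Cons a w)
  obtain s b where a: "a = (s, b)" by force
  \<comment> \<open>The inner word \<open>w @ inv_word w\<close> cancels first, which makes the
    outer letters adjacent.\<close>
  with Cons have "([(s, b)] @ (w @ inv_word w) @ [(s, \<not> b)], [(s, b)] @ [] @ [(s, \<not> b)]) \<in> free_rel S"
    by (intro free_rel_context) auto
  moreover have "([(s, b), (s, \<not> b)], []) \<in> free_rel S"
    using free_rel.cancel[of "[]" S "[]" s b] Cons.prems a by simp
  ultimately show ?case using a by (auto intro: free_rel.trans)
qed

lemma inv_word_append_free_rel:
  "w \<in> words S \<Longrightarrow> (inv_word w @ w, []) \<in> free_rel S"
  using append_inv_word_free_rel[of "inv_word w" S] by simp

section \<open>Products of conjugates and area\<close>

lemma conj_prod_append [simp]: "conj_prod (ps @ qs) = conj_prod ps @ conj_prod qs"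
  by (simp add: conj_prod_def)

text \<open>Conjugation is multiplicative and turns the conjugator \<open>u\<close> into
  \<open>x @ u\<close>. The relators and the number of factors stay the same, so conjugating a word
  does not raise its area.\<close>

lemma conj_prod_conjugate:
  assumes "x \<in> words S" "set ps \<subseteq> words S \<times> words S"
  shows "(x @ conj_prod ps @ inv_word x, conj_prod (map (\<lambda>(u, r). (x @ u, r)) ps)) \<in> free_rel S"
  using assms(2)
proof (induction ps)
  case Nil
  then show ?case by (simp add: conj_prod_def append_inv_word_free_rel assms)
next
  case (Cons p ps)
  obtain u r where p: "p = (u, r)" by force
  define c where "c = u @ r @ inv_word u"
  have c: "c \<in> words S" using Cons.prems by (auto simp: c_def p)
  have ps: "conj_prod ps \<in> words S"
    using free_rel_in_words(1)[OF Cons.IH] Cons.prems by simp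
  \<comment> \<open>Inserting \<open>inv_word x @ x\<close> after the first factor \<open>c\<close>
    splits the conjugate into two, the second of which is covered by the induction
    hypothesis.\<close>
  have "(x @ c @ (inv_word x @ x) @ (conj_prod ps @ inv_word x),
         x @ c @ [] @ (conj_prod ps @ inv_word x)) \<in> free_rel S"
    using free_rel_context[OF inv_word_append_free_rel[OF assms(1)], of "x @ c" "conj_prod ps @ inv_word x"]
      assms(1) c ps by simp
  moreover have "((x @ c @ inv_word x) @ (x @ conj_prod ps @ inv_word x),
      (x @ c @ inv_word x) @ conj_prod (map (\<lambda>(u, r). (x @ u, r)) ps)) \<in> free_rel S"
    using Cons c assms(1) by (intro free_rel_append free_rel.refl) auto
  ultimately have "(x @ c @ conj_prod ps @ inv_word x,
      x @ c @ inv_word x @ conj_prod (map (\<lambda>(u, r). (x @ u, r)) ps)) \<in> free_rel S"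
    by (auto intro: free_rel.trans free_rel.sym)
  then show ?case by (simp add: conj_prod_def p c_def)
qed

text \<open>The infimum of a nonempty set of extended naturals is attained, so a finite bound on the
  area yields an actual product of conjugates.\<close>

lemma area_le_enat_iff:
  "area G S l w \<le> enat m \<longleftrightarrow> (\<exists>ps. length ps \<le> m \<and>
     set ps \<subseteq> words S \<times> {r \<in> relations G S. length r \<le> l} \<and> (w, conj_prod ps) \<in> free_rel S)"
  (is "_ \<longleftrightarrow> ?P m")
proof
  define A where "A = {enat m | m. ?P m}"
  have area: "area G S l w = Inf A" by (simp add: area_def A_def)
  assume le: "area G S l w \<le> enat m"
  \<comment> \<open>The infimum of the empty set would be infinite.\<close>
  then have "A \<noteq> {}" using area by (auto simp: Inf_enat_def)
  then have "Inf A \<in> A" by (auto simp: Inf_enat_def intro: LeastI)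
  then obtain m' where "Inf A = enat m'" "?P m'" by (auto simp: A_def)
  moreover from this have "m' \<le> m" using le area by simp
  ultimately show "?P m" by (meson order_trans)
next
  assume "?P m"
  then show "area G S l w \<le> enat m"
    unfolding area_def by (intro Inf_lower) auto
qed

lemma area_Nil [simp]: "area G S l [] = 0"
proof -
  have "area G S l [] \<le> enat 0"
    by (subst area_le_enat_iff) (auto simp: conj_prod_def free_rel.refl)
  then show ?thesis by (simp add: zero_enat_def[symmetric])
qed

lemma area_replace_subword:
  assumes "x \<in> words S" "u \<in> words S" "v \<in> words S" "y \<in> words S"
  shows "area G S l (x @ u @ y) \<le> area G S l (u @ inv_word v) + area G S l (x @ v @ y)"
\<comment> \<open>Only two finite areas provide factorizations to concatenate; if either is
  infinite, the bound is trivial.\<close>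
proof (cases "area G S l (u @ inv_word v)"; cases "area G S l (x @ v @ y)")
  fix a b
  assume a: "area G S l (u @ inv_word v) = enat a" and b: "area G S l (x @ v @ y) = enat b"
  let ?R = "{r \<in> relations G S. length r \<le> l}"
  obtain ps where ps: "length ps \<le> a" "set ps \<subseteq> words S \<times> ?R"
    "(u @ inv_word v, conj_prod ps) \<in> free_rel S"
    using area_le_enat_iff[of G S l "u @ inv_word v" a] a by auto
  obtain qs where qs: "length qs \<le> b" "set qs \<subseteq> words S \<times> ?R"
    "(x @ v @ y, conj_prod qs) \<in> free_rel S"
    using area_le_enat_iff[of G S l "x @ v @ y" b] b by auto
  define ps' where "ps' = map (\<lambda>(u, r). (x @ u, r)) ps"
  have "(x @ (u @ inv_word v) @ inv_word x, x @ conj_prod ps @ inv_word x) \<in> free_rel S"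
    using ps assms by (intro free_rel_context) auto
  moreover have "(x @ conj_prod ps @ inv_word x, conj_prod ps') \<in> free_rel S"
    unfolding ps'_def using ps(2) assms(1)
    by (intro conj_prod_conjugate) (auto simp: relations_def)
  ultimately have *: "((x @ (u @ inv_word v) @ inv_word x) @ (x @ v @ y), conj_prod (ps' @ qs)) \<in> free_rel S"
    using qs(3) by (simp only: conj_prod_append) (blast intro: free_rel_append free_rel.trans)
  \<comment> \<open>In the product of the conjugate with \<open>x @ v @ y\<close>, first
    \<open>inv_word x @ x\<close> cancels and then \<open>inv_word v @ v\<close>.\<close>
  have "((x @ u @ inv_word v) @ (inv_word x @ x) @ (v @ y), (x @ u @ inv_word v) @ [] @ (v @ y)) \<in> free_rel S"
    using assms by (intro free_rel_context inv_word_append_free_rel) auto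
  moreover have "((x @ u) @ (inv_word v @ v) @ y, (x @ u) @ [] @ y) \<in> free_rel S"
    using assms by (intro free_rel_context inv_word_append_free_rel) auto
  ultimately have "((x @ (u @ inv_word v) @ inv_word x) @ (x @ v @ y), x @ u @ y) \<in> free_rel S"
    by (auto intro: free_rel.trans)
  with * have "(x @ u @ y, conj_prod (ps' @ qs)) \<in> free_rel S"
    by (blast intro: free_rel.trans free_rel.sym)
  moreover have "set (ps' @ qs) \<subseteq> words S \<times> ?R"
    using ps(2) qs(2) assms(1) by (auto simp: ps'_def)
  moreover have "length (ps' @ qs) \<le> a + b"
    using ps(1) qs(1) by (simp add: ps'_def)
  ultimately have "area G S l (x @ u @ y) \<le> enat (a + b)"
    unfolding area_le_enat_iff by blast
  then show ?thesis using a b by simp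
qed auto

text \<open>Pieces are replaced from left to right. The prefix \<open>x\<close> is arbitrary because
  each replaced piece joins it: the induction hypothesis is applied to \<open>x @ v\<close>.\<close>

lemma area_replace_subwords:
  assumes "list_all2 (\<lambda>u v. u \<in> words S \<and> v \<in> words S \<and> area G S l (u @ inv_word v) \<le> D) us vs"
    and "x \<in> words S"
  shows "area G S l (x @ concat us) \<le> enat (length us) * D + area G S l (x @ concat vs)"
  using assms
proof (induction us vs arbitrary: x rule: list_all2_induct)
  case Nil
  then show ?case by simp
next
  case (Cons u us v vs)
  have us: "concat us \<in> words S"
    using Cons.hyps(2) by (induction rule: list_all2_induct) auto
  have "area G S l (x @ u @ concat us) \<le> area G S l (u @ inv_word v) + area G S l (x @ v @ concat us)"
    using Cons.hyps Cons.prems us by (intro area_replace_subword) auto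
  also have "\<dots> \<le> D + (enat (length us) * D + area G S l ((x @ v) @ concat vs))"
    using Cons.hyps Cons.prems Cons.IH[of "x @ v"] by (intro add_mono) auto
  also have "\<dots> = enat (length (u # us)) * D + area G S l (x @ concat (v # vs))"
    by (simp add: eSuc_enat[symmetric] mult_eSuc add.assoc)
  finally show ?case by simp
qed

text \<open>Cut off \<open>m\<close> letters \<open>k\<close> times. Pieces may be short or empty,
  which keeps their number exactly \<open>k\<close> without any divisibility condition.\<close>

lemma split_list_bounded_pieces:
  "length w \<le> k * m \<Longrightarrow> \<exists>ws. length ws = k \<and> concat ws = w \<and> (\<forall>u\<in>set ws. length u \<le> m)"
proof (induction k arbitrary: w)
  case 0
  then show ?case by simp
next
  case (Suc k)
  then have "length (drop m w) \<le> k * m" by simp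
  then obtain ws where "length ws = k" "concat ws = drop m w" "\<forall>u\<in>set ws. length u \<le> m"
    using Suc.IH by blast
  then show ?case by (intro exI[of _ "take m w # ws"]) auto
qed

section \<open>Values of words in the group\<close>

context group
begin

lemma word_value_closed: "S \<subseteq> carrier G \<Longrightarrow> w \<in> words S \<Longrightarrow> word_value G w \<in> carrier G"
  by (induction w) (auto simp: word_value_def)

lemma word_value_append:
  assumes "S \<subseteq> carrier G" "u \<in> words S" "v \<in> words S"
  shows "word_value G (u @ v) = word_value G u \<otimes> word_value G v"
  using assms(2)
proof (induction u)
  case Nil
  have "word_value G [] = \<one>" by (simp add: word_value_def)
  then show ?case using word_value_closed[OF assms(1,3)] by simp
next
  case (Cons a u)
  obtain s b where a: "a = (s, b)" by force
  have Cons_value: "word_value G (a # w) = (if b then s else inv s) \<otimes> word_value G w" for w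
    by (simp add: word_value_def a)
  have "s \<in> carrier G" "u \<in> words S" using Cons.prems a assms(1) by auto
  then show ?case
    using Cons word_value_closed[OF assms(1)] assms(3)
    by (simp add: Cons_value m_assoc)
qed

lemma word_value_inv_word:
  assumes "S \<subseteq> carrier G" "w \<in> words S"
  shows "word_value G (inv_word w) = inv (word_value G w)"
  using assms(2)
proof (induction w)
  case Nil
  then show ?case by (simp add: word_value_def)
next
  case (Cons a w)
  obtain s b where a: "a = (s, b)" by force
  have s: "s \<in> S" "s \<in> carrier G" and w: "w \<in> words S" using Cons.prems a assms(1) by auto
  have "word_value G (inv_word (a # w)) = word_value G (inv_word w) \<otimes> word_value G [(s, \<not> b)]"
    using word_value_append[OF assms(1), of "inv_word w" "[(s, \<not> b)]"] s w by (simp add: a)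
  also have "\<dots> = inv (word_value G w) \<otimes> inv (if b then s else inv s)"
    using Cons.IH w s by (simp add: word_value_def)
  also have "\<dots> = inv ((if b then s else inv s) \<otimes> word_value G w)"
    using s word_value_closed[OF assms(1) w] by (simp add: inv_mult_group)
  also have "\<dots> = inv (word_value G (a # w))"
    by (simp add: a word_value_def)
  finally show ?case .
qed

lemma append_inv_word_in_relations:
  assumes "S \<subseteq> carrier G" "u \<in> words S" "v \<in> words S" "word_value G u = word_value G v"
  shows "u @ inv_word v \<in> relations G S"
  using assms word_value_closed[OF assms(1,3)]
  by (simp add: relations_def word_value_append word_value_inv_word)

text \<open>This ensures that replacing the pieces of a relation gives a relation again. Membership
  in \<open>words S\<close> is carried through the induction because multiplicativity of
  \<open>word_value\<close> asks for it.\<close>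

lemma word_value_concat_cong:
  assumes "S \<subseteq> carrier G"
    and "list_all2 (\<lambda>u v. u \<in> words S \<and> v \<in> words S \<and> word_value G u = word_value G v) us vs"
  shows "concat us \<in> words S \<and> concat vs \<in> words S \<and>
    word_value G (concat us) = word_value G (concat vs)"
  using assms(2) by (induction rule: list_all2_induct) (auto simp: word_value_append[OF assms(1)])

end

section \<open>Dehn functions and the efficiency constant\<close>

lemma area_le_dehn:
  "w \<in> relations G S \<Longrightarrow> real (length w) \<le> x \<Longrightarrow> area G S l w \<le> dehn G S l x"
  unfolding dehn_def by (intro Sup_upper) auto

lemma area_le_restricted_dehn:
  "w \<in> relations G S \<Longrightarrow> real (length w) \<le> x \<Longrightarrow> w \<in> F \<Longrightarrow> area G S l w \<le> restricted_dehn G S l F x"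
  unfolding restricted_dehn_def by (intro Sup_upper) auto

lemma dehn_mono: "x \<le> y \<Longrightarrow> dehn G S l x \<le> dehn G S l y"
  unfolding dehn_def by (intro Sup_subset_mono) auto

lemma restricted_dehn_mono: "x \<le> y \<Longrightarrow> restricted_dehn G S l F x \<le> restricted_dehn G S l F y"
  unfolding restricted_dehn_def by (intro Sup_subset_mono) auto

text \<open>The empty word is the only word without letters, and its area is 0.\<close>

lemma dehn_empty_generators [simp]: "dehn G {} l x = 0"
proof -
  have "area G {} l w \<le> 0" if "w \<in> relations G {}" for w
    using that by (simp add: relations_def words_def)
  then have "dehn G {} l x \<le> 0"
    unfolding dehn_def by (intro Sup_least) auto
  then show ?thesis by simp
qed

text \<open>Efficiency applied to a single letter bounds a length by \<open>C\<close>.\<close>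

lemma efficiency_constant_nonneg:
  assumes "efficient G S F C" "S \<noteq> {}"
  shows "C \<ge> 0"
proof -
  obtain s where "s \<in> S" using assms(2) by blast
  then have "[(s, True)] \<in> words S" by simp
  then obtain w' :: "'a word" where "real (length w') \<le> C * real (length [(s, True)])"
    using assms(1) unfolding efficient_def by blast
  then show ?thesis by simp
qed

section \<open>The estimate for one relation, then for the Dehn function\<close>

text \<open>The core estimate with a natural number \<open>m\<close> in place of the ceiling: the
  first summand pays for \<open>k\<close> replacements, the second for the relation in
  \<open>concats F k\<close> that remains.\<close>

lemma (in group) area_le_dehn_restricted_dehn:
  assumes S: "S \<subseteq> carrier G" and F: "F \<subseteq> words S" and eff: "efficient G S F C" and C: "C \<ge> 0"
    and w: "w \<in> relations G S" "length w \<le> k * m"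
  shows "area G S l w \<le> enat k * dehn G S l ((C + 1) * real m)
    + restricted_dehn G S l (concats F k) (C * real k * real m)"
proof -
  obtain us where us: "length us = k" "concat us = w" "\<forall>u\<in>set us. length u \<le> m"
    using split_list_bounded_pieces[OF w(2)] by blast
  have us_words: "set us \<subseteq> words S"
    using w(1) us(2) by (auto simp: relations_def simp flip: concat_in_words_iff)
  obtain f where f: "\<And>u. u \<in> words S \<Longrightarrow>
      f u \<in> F \<and> word_value G (f u) = word_value G u \<and> real (length (f u)) \<le> C * real (length u)"
    using eff unfolding efficient_def by metis
  define vs where "vs = map f us"
  have len_f: "real (length (f u)) \<le> C * real m" if "u \<in> set us" for u
  proof -
    have "real (length (f u)) \<le> C * real (length u)" using f us_words that by blast
    \<comment> \<open>Passing from \<open>length u\<close> to its bound \<open>m\<close> uses that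
      \<open>C\<close> is nonnegative.\<close>
    also have "\<dots> \<le> C * real m" using us(3) that C by (intro mult_left_mono) auto
    finally show ?thesis .
  qed
  have "area G S l (u @ inv_word (f u)) \<le> dehn G S l ((C + 1) * real m)" if "u \<in> set us" for u
  proof (rule area_le_dehn)
    show "u @ inv_word (f u) \<in> relations G S"
      using S F f[of u] us_words that by (intro append_inv_word_in_relations) auto
    show "real (length (u @ inv_word (f u))) \<le> (C + 1) * real m"
      using len_f[OF that] us(3) that by (auto simp: algebra_simps intro: add_mono)
  qed
  \<comment> \<open>Since \<open>vs\<close> is \<open>map f us\<close>, the relation between the
    lists reduces to a property of each \<open>u\<close> in \<open>us\<close>.\<close>
  then have "list_all2 (\<lambda>u v. u \<in> words S \<and> v \<in> words S \<and>
      area G S l (u @ inv_word v) \<le> dehn G S l ((C + 1) * real m)) us vs"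
    using f F us_words unfolding vs_def list_all2_map2 by (intro list.rel_refl_strong) auto
  from area_replace_subwords[OF this Nil_in_words]
  have area: "area G S l w \<le> enat k * dehn G S l ((C + 1) * real m) + area G S l (concat vs)"
    using us by simp
  have "list_all2 (\<lambda>u v. u \<in> words S \<and> v \<in> words S \<and> word_value G u = word_value G v) us vs"
    using f F us_words unfolding vs_def list_all2_map2 by (intro list.rel_refl_strong) auto
  from word_value_concat_cong[OF S this] have "concat vs \<in> relations G S"
    using w(1) us(2) by (simp add: relations_def)
  moreover have "real (length (concat vs)) \<le> C * real k * real m"
  proof -
    have "real (length (concat vs)) = (\<Sum>u\<leftarrow>us. real (length (f u)))"
      unfolding vs_def by (induction us) auto
    also have "\<dots> \<le> (\<Sum>u\<leftarrow>us. C * real m)" by (intro sum_list_mono len_f)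
    also have "\<dots> = C * real k * real m" by (simp add: sum_list_triv us(1))
    finally show ?thesis .
  qed
  moreover have "concat vs \<in> concats F k"
    using f us_words us(1) unfolding concats_def vs_def
    by (intro CollectI exI[of _ "map f us"]) (auto dest!: subsetD)
  ultimately have "area G S l (concat vs) \<le> restricted_dehn G S l (concats F k) (C * real k * real m)"
    by (rule area_le_restricted_dehn)
  with area show ?thesis by (meson add_left_mono order_trans)
qed

theorem lemma4p2:
  fixes G :: "('a, 'b) monoid_scheme" and T :: "'a topology" and S :: "'a set"
    and l k :: nat and F :: "'a word set" and C n :: real
  assumes "locally_compact_group G T"
    and "compactin T S" and "symmetric_subset G S" and "generate G S = carrier G"
    and "presented_with_relators_le G S l"
    and "F \<subseteq> words S" and "efficient G S F C"
    and "k \<ge> 1" and "n > 0"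
  shows "dehn G S l n \<le>
           enat k * dehn G S l ((C + 1) * real_of_int \<lceil>n / real k\<rceil>)
           + restricted_dehn G S l (concats F k) (C * real k * real_of_int \<lceil>n / real k\<rceil>)
         \<and> (n \<ge> real k \<longrightarrow>
           dehn G S l n \<le>
             enat k * dehn G S l ((C + 1) * (2 * n / real k))
             + restricted_dehn G S l (concats F k) (2 * C * n))"
proof (cases "S = {}")
  \<comment> \<open>Without letters the efficiency constant may be negative.\<close>
  case True
  then show ?thesis by simp
next
  case False
  interpret group G using assms(1) by (simp add: locally_compact_group_def)
  have S: "S \<subseteq> carrier G" using assms(3) by (simp add: symmetric_subset_def)
  have C: "C \<ge> 0" using efficiency_constant_nonneg[OF assms(7) False] .
  \<comment> \<open>The ceiling is positive because \<open>n / real k\<close> is, so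
    \<open>nat\<close> does not change its value.\<close>
  define m where "m = nat \<lceil>n / real k\<rceil>"
  have "n / real k > 0" using assms(8,9) by simp
  then have m: "real m = real_of_int \<lceil>n / real k\<rceil>" by (simp add: m_def)
  have "n / real k \<le> real m" unfolding m by (rule le_of_int_ceiling)
  then have "n \<le> real k * real m" using assms(8) by (simp add: field_simps)
  then have "length w \<le> k * m" if "real (length w) \<le> n" for w :: "'a word"
    using that by (metis of_nat_le_iff of_nat_mult order_trans)
  then have main: "dehn G S l n \<le> enat k * dehn G S l ((C + 1) * real m)
      + restricted_dehn G S l (concats F k) (C * real k * real m)"
    unfolding dehn_def[of G S l n]
    by (auto intro!: Sup_least area_le_dehn_restricted_dehn[OF S assms(6,7) C])
  have "dehn G S l n \<le> enat k * dehn G S l ((C + 1) * (2 * n / real k))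
      + restricted_dehn G S l (concats F k) (2 * C * n)" if "n \<ge> real k"
  proof -
    \<comment> \<open>For \<open>n \<ge> real k\<close> the rounding error of at most 1 is absorbed
      by a second copy of \<open>n / real k\<close>, whence the factor 2.\<close>
    have "1 \<le> n / real k" using that assms(8) by simp
    moreover have "real m \<le> n / real k + 1"
      unfolding m by (rule of_int_ceiling_le_add_one)
    ultimately have m2: "real m \<le> 2 * n / real k" by linarith
    have "C * real k * real m \<le> C * real k * (2 * n / real k)"
      using m2 C by (intro mult_left_mono) auto
    also have "\<dots> = 2 * C * n" using assms(8) by simp
    finally have "restricted_dehn G S l (concats F k) (C * real k * real m)
        \<le> restricted_dehn G S l (concats F k) (2 * C * n)"
      by (rule restricted_dehn_mono)
    \<comment> \<open>The factor \<open>C + 1\<close> is nonnegative, so the bound on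
      \<open>m\<close> enlarges the argument of the Dehn function.\<close>
    moreover have "dehn G S l ((C + 1) * real m) \<le> dehn G S l ((C + 1) * (2 * n / real k))"
      using m2 C by (intro dehn_mono mult_left_mono) auto
    ultimately show ?thesis
      using main by (meson add_mono mult_left_mono order_trans zero_le)
  qed
  with main show ?thesis unfolding m by blast
qed

end
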